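(* Let $m\geq 1$ and let $L=\{1^{a_1},2^{a_2},\ldots,m^{a_m}\}$ be an admissible list with $a_1\geq a_2\geq\cdots\geq a_m>0$, and let $v=|L|+1$. Then there exists a Hamiltonian path $H$ of $K_v$ with $\ell(H)=L$.
   Context: $K_v$ is the complete graph on vertex set $\{0,1,\ldots,v-1\}$. The length of an edge $[x,y]$ is $\min(|x-y|,\,v-|x-y|)$, and for a subgraph $H$, $\ell(H)$ is the list (multiset) of lengths of its edges. The notation $\{1^{a_1},\ldots,m^{a_m}\}$ denotes the multiset containing $a_i$ copies of $i$; $|L|=\sum a_i$. A list $L$ of $v-1$ positive integers not exceeding $\lfloor v/2\rfloor$ is called admissible if for every divisor $d$ of $v$, the number of elements of $L$ (with multiplicity) that are multiples of $d$ is at most $v-d$. *)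

theory Defs
  imports "HOL-Library.Multiset"
begin

text \<open>A simple graph is given by its vertex set and its set of edges, each edge being a
  two-element set of vertices.\<close>

type_synonym 'a sgraph = "'a set \<times> 'a set set"

definition complete_graph :: "nat \<Rightarrow> nat sgraph" where
  "complete_graph v = ({0..<v}, {{x, y} | x y. x < v \<and> y < v \<and> x \<noteq> y})"

definition path_edges :: "'a list \<Rightarrow> 'a set set" where
  "path_edges p = {{p ! i, p ! Suc i} | i. Suc i < length p}"

text \<open>The path is the subgraph itself; the list \<open>p\<close> of its vertices in order is
  only a witness.\<close>

definition hamiltonian_path :: "'a sgraph \<Rightarrow> 'a sgraph \<Rightarrow> bool" where
  "hamiltonian_path G H \<longleftrightarrow>
     (\<exists>p. distinct p \<and> set p = fst G \<and> path_edges p \<subseteq> snd G \<and> H = (set p, path_edges p))"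

text \<open>For \<open>e = {x, y}\<close> the number \<open>Max e - Min e\<close> is \<open>\<bar>x - y\<bar>\<close>.\<close>

definition edge_length :: "nat \<Rightarrow> nat set \<Rightarrow> nat" where
  "edge_length v e = min (Max e - Min e) (v - (Max e - Min e))"

definition length_list :: "nat \<Rightarrow> nat sgraph \<Rightarrow> nat multiset" where
  "length_list v H = image_mset (edge_length v) (mset_set (snd H))"

definition exp_mset :: "nat \<Rightarrow> (nat \<Rightarrow> nat) \<Rightarrow> nat multiset" where
  "exp_mset m a = (\<Sum>i = 1..m. replicate_mset (a i) i)"

definition admissible :: "nat \<Rightarrow> nat multiset \<Rightarrow> bool" where
  "admissible v L \<longleftrightarrow>
     size L + 1 = v \<and>
     (\<forall>x \<in># L. 1 \<le> x \<and> x \<le> v div 2) \<and>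
     (\<forall>d. d dvd v \<longrightarrow> size {#x \<in># L. d dvd x#} \<le> v - d)"

end

theory Submission
  imports Defs
begin

text \<open>
  Since the entries of \<open>L\<close> are at most \<open>v div 2\<close>, it suffices to order \<open>0, \<dots>, v - 1\<close> such that the
  absolute differences of neighbours form \<open>L\<close>. As \<open>a\<close> is non-increasing, \<open>L\<close> is the sum of sets
  \<open>{1..m\<^sub>j}\<close> (the conjugate partition). Taking the \<open>m\<^sub>j\<close> in increasing order, each one
  contributes a new block of \<open>m\<^sub>j\<close> vertices above the old ones: the path jumps into it by a step of
  length \<open>m\<^sub>j\<close> and then traverses it with differences \<open>1, \<dots>, m\<^sub>j - 1\<close>. The jump lands inside
  the block because the previous block is not larger.

  The point of landing cannot be chosen, so one needs a graceful labelling of a path with any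
  prescribed first label \<open>t\<close>. For \<open>t\<close> small compared to \<open>N\<close>, start with a zigzag
  \<open>t, N - t + 1, t - 1, N - t + 2, \<dots>, N, 0\<close>, which uses up the largest differences, and continue
  recursively in the gap that is left. Keeping the path alternating between the labels up to
  \<open>N div 2\<close> and those above makes it possible to reverse each half separately, which replaces
  \<open>t\<close> by \<open>N div 2 - t\<close>; this handles large \<open>t\<close>. Only \<open>N = 4 t\<close> escapes, and there one non-alternating
  step of the recursion helps.
\<close>

section \<open>Difference lists and zigzag paths\<close>

fun diffs :: "int list \<Rightarrow> int list" where
  "diffs (x # y # zs) = \<bar>x - y\<bar> # diffs (y # zs)"
| "diffs _ = []"

text \<open>\<open>p \<noteq> []\<close> excludes negative \<open>N\<close>, for which the empty
  list satisfies both equations.\<close>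

definition graceful_path :: "int \<Rightarrow> int list \<Rightarrow> bool" where
  "graceful_path N p \<longleftrightarrow>
     p \<noteq> [] \<and> mset p = mset_set {0..N} \<and> mset (diffs p) = mset_set {1..N}"

text \<open>A graceful path on \<open>0..N\<close> that alternates about some \<open>K\<close> is an
  alpha-labelling of the path.\<close>

definition alternating :: "int \<Rightarrow> int list \<Rightarrow> bool" where
  "alternating K p \<longleftrightarrow> successively (\<lambda>x y. (x \<le> K) \<noteq> (y \<le> K)) p"

text \<open>\<open>c\<close> is the next difference; each call uses up \<open>c\<close> and
  \<open>c + 1\<close>.\<close>

fun zigzag :: "nat \<Rightarrow> int \<Rightarrow> int list" where
  "zigzag 0 c = [0]"
| "zigzag (Suc t) c = int (Suc t) # (int (Suc t) + c) # zigzag t (c + 2)"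

lemma diffs_append:
  "p \<noteq> [] \<Longrightarrow> q \<noteq> [] \<Longrightarrow> diffs (p @ q) = diffs p @ \<bar>last p - hd q\<bar> # diffs q"
  by (induction p rule: diffs.induct) (auto simp: neq_Nil_conv)

lemma diffs_map_shift: "diffs (map (\<lambda>x. x + c) p) = diffs p"
  by (induction p rule: diffs.induct) auto

lemma diffs_map_reflect: "diffs (map (\<lambda>x. c - x) p) = diffs p"
  by (induction p rule: diffs.induct) auto

lemma mset_set_atLeastAtMost_image_shift:
  "image_mset (\<lambda>x. x + c) (mset_set {a..b::int}) = mset_set {a + c..b + c}"
  by (subst image_mset_mset_set) (auto intro: inj_onI simp: add.commute)

lemma mset_set_atLeastAtMost_image_reflect:
  "image_mset (\<lambda>x. c - x) (mset_set {a..b::int}) = mset_set {c - b..c - a}"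
  by (subst image_mset_mset_set) (auto intro: inj_onI)

lemma mset_set_atLeastAtMost_join:
  fixes a b c :: int
  assumes "a \<le> b + 1" "b \<le> c"
  shows "mset_set {a..b} + mset_set {b + 1..c} = mset_set {a..c}"
proof -
  have "{a..c} = {a..b} \<union> {b + 1..c}" using assms by auto
  then show ?thesis by (simp add: mset_set_Union)
qed

lemma zigzag_not_Nil [simp]: "zigzag t c \<noteq> []"
  by (cases t) auto

lemma hd_zigzag [simp]: "hd (zigzag t c) = int t"
  by (cases t) auto

lemma last_zigzag [simp]: "last (zigzag t c) = 0"
  by (induction t c rule: zigzag.induct) auto

lemma mset_zigzag:
  "mset (zigzag t c) = mset_set {0..int t} + mset_set {int t + c..2 * int t + c - 1}"
proof (induction t c rule: zigzag.induct)
  case (2 t c)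
  have "mset_set {0..int (Suc t)} = mset_set {0..int t} + {#int (Suc t)#}"
    using mset_set_atLeastAtMost_join[of 0 "int t" "int t + 1"] by (simp add: add.commute)
  moreover have "mset_set {int (Suc t) + c..2 * int (Suc t) + c - 1} =
      {#int (Suc t) + c#} + mset_set {int t + (c + 2)..2 * int t + (c + 2) - 1}"
    using mset_set_atLeastAtMost_join[of "int t + 1 + c" "int t + 1 + c" "2 * int t + c + 1"]
    by (simp add: algebra_simps)
  ultimately show ?case using 2 by simp
qed auto

lemma mset_diffs_zigzag:
  "c > 0 \<Longrightarrow> mset (diffs (zigzag t c)) = mset_set {c..2 * int t + c - 1}"
proof (induction t c rule: zigzag.induct)
  case (2 t c)
  have "diffs (zigzag (Suc t) c) = c # (c + 1) # diffs (zigzag t (c + 2))"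
    using diffs_append[of "[int (Suc t), int (Suc t) + c]" "zigzag t (c + 2)"] 2 by simp
  moreover have "mset_set {c..2 * int (Suc t) + c - 1} =
      {#c#} + ({#c + 1#} + mset_set {c + 2..2 * int t + (c + 2) - 1})"
    using mset_set_atLeastAtMost_join[of c c "2 * int t + c + 1"]
      mset_set_atLeastAtMost_join[of "c + 1" "c + 1" "2 * int t + c + 1"]
    by (simp add: algebra_simps)
  ultimately show ?case using 2 by simp
qed auto

lemma alternating_append:
  assumes "p \<noteq> []" "q \<noteq> []" "alternating K p" "alternating K q"
    and "(last p \<le> K) \<noteq> (hd q \<le> K)"
  shows "alternating K (p @ q)"
  using assms by (auto simp: alternating_def successively_append_iff)

lemma alternating_zigzag:
  "int t \<le> K \<Longrightarrow> K < int t + c \<Longrightarrow> alternating K (zigzag t c)"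
proof (induction t c rule: zigzag.induct)
  case (2 t c)
  then show ?case
    using alternating_append[of "[int (Suc t), int (Suc t) + c]" "zigzag t (c + 2)" K]
    by (auto simp: alternating_def)
qed (auto simp: alternating_def)

section \<open>Extending a graceful path by a zigzag\<close>

lemma graceful_path_nonneg: "graceful_path N p \<Longrightarrow> 0 \<le> N"
  unfolding graceful_path_def by (metis atLeastatMost_empty_iff mset_set.empty mset_zero_iff)

lemma set_eq_interval: "mset p = mset_set {a..b::int} \<Longrightarrow> set p = {a..b}"
  by (metis finite_atLeastAtMost_int finite_set_mset_mset_set set_mset_mset)

lemma set_graceful_path: "graceful_path N p \<Longrightarrow> set p = {0..N}"
  by (simp add: graceful_path_def set_eq_interval)

text \<open>The two versions differ in whether the zigzag stops at \<open>0\<close> or at \<open>N\<close>, that is, in the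
  parity of the number of its steps.\<close>

definition wrap_even :: "nat \<Rightarrow> int \<Rightarrow> int list \<Rightarrow> int list" where
  "wrap_even t N p = zigzag t (N - 2 * int t + 1) @ map (\<lambda>x. (N - int t) - x) p"

definition wrap_odd :: "nat \<Rightarrow> int \<Rightarrow> int list \<Rightarrow> int list" where
  "wrap_odd t N p = zigzag t (N - 2 * int t) @ N # map (\<lambda>x. x + (int t + 1)) p"

lemma hd_wrap [simp]: "hd (wrap_even t N p) = int t" "hd (wrap_odd t N p) = int t"
  by (simp_all add: wrap_even_def wrap_odd_def)

text \<open>The zigzag leaves the labels \<open>t + 1..N - t\<close>. Reflected into this gap,
  \<open>p\<close> starts at \<open>N - 2 * t\<close>, so the jump from \<open>0\<close> supplies
  the largest missing difference.\<close>

lemma graceful_path_wrap_even: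
  assumes p: "graceful_path (N - 2 * int t - 1) p" and hd: "hd p = int t"
  shows "graceful_path N (wrap_even t N p)"
proof -
  let ?c = "N - 2 * int t + 1"
  have N: "N - 2 * int t - 1 \<ge> 0" using graceful_path_nonneg[OF p] .
  have ne: "p \<noteq> []" using p by (simp add: graceful_path_def)
  have "mset (wrap_even t N p) = mset_set {0..int t} + mset_set {int t + 1..N - int t}
      + mset_set {N - int t + 1..N}"
    using p mset_set_atLeastAtMost_image_reflect[of "N - int t" 0 "N - 2 * int t - 1"]
    by (simp add: wrap_even_def mset_zigzag graceful_path_def add.commute)
  also have "\<dots> = mset_set {0..N}"
    using N by (simp add: mset_set_atLeastAtMost_join)
  finally have 1: "mset (wrap_even t N p) = mset_set {0..N}" .
  have "diffs (wrap_even t N p) = diffs (zigzag t ?c) @ (N - 2 * int t) # diffs p"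
    using N ne hd by (simp add: wrap_even_def diffs_append hd_map diffs_map_reflect)
  then have "mset (diffs (wrap_even t N p)) = mset_set {1..N - 2 * int t - 1}
      + mset_set {N - 2 * int t..N - 2 * int t} + mset_set {N - 2 * int t + 1..N}"
    using p N by (simp add: mset_diffs_zigzag graceful_path_def algebra_simps)
  also have "\<dots> = mset_set {1..N}"
    using N mset_set_atLeastAtMost_join[of 1 "N - 2 * int t - 1" "N - 2 * int t"]
      mset_set_atLeastAtMost_join[of 1 "N - 2 * int t" N] by simp
  finally show ?thesis using 1 by (simp add: graceful_path_def wrap_even_def)
qed

text \<open>Here the gap is \<open>t + 1..N - t - 1\<close>. The shifted \<open>p\<close> starts at
  \<open>2 * t + 1\<close>, so the jump from \<open>N\<close> has the missing length
  \<open>N - 2 * t - 1\<close>.\<close>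

lemma graceful_path_wrap_odd:
  assumes p: "graceful_path (N - 2 * int t - 2) p" and hd: "hd p = int t"
  shows "graceful_path N (wrap_odd t N p)"
proof -
  let ?c = "N - 2 * int t"
  have N: "N - 2 * int t - 2 \<ge> 0" using graceful_path_nonneg[OF p] .
  have ne: "p \<noteq> []" using p by (simp add: graceful_path_def)
  have "mset (wrap_odd t N p) = mset_set {0..int t} + mset_set {int t + 1..N - int t - 1}
      + (mset_set {N - int t..N - 1} + mset_set {N..N})"
    using p mset_set_atLeastAtMost_image_shift[of "int t + 1" 0 "N - 2 * int t - 2"]
    by (simp add: wrap_odd_def mset_zigzag graceful_path_def algebra_simps)
  also have "\<dots> = mset_set {0..N}"
    using N mset_set_atLeastAtMost_join[of "N - int t" "N - 1" N]
      mset_set_atLeastAtMost_join[of 0 "int t" "N - int t - 1"]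
      mset_set_atLeastAtMost_join[of 0 "N - int t - 1" N] by simp
  finally have 1: "mset (wrap_odd t N p) = mset_set {0..N}" .
  have "diffs (wrap_odd t N p) = diffs (zigzag t ?c) @ N # (N - 2 * int t - 1) # diffs p"
    using N ne hd diffs_append[of "[N]" "map (\<lambda>x. x + (int t + 1)) p"]
    by (simp add: wrap_odd_def diffs_append hd_map diffs_map_shift)
  then have "mset (diffs (wrap_odd t N p)) = mset_set {1..N - 2 * int t - 2}
      + mset_set {N - 2 * int t - 1..N - 2 * int t - 1}
      + (mset_set {N - 2 * int t..N - 1} + mset_set {N..N})"
    using p N by (simp add: mset_diffs_zigzag graceful_path_def algebra_simps)
  also have "\<dots> = mset_set {1..N}"
    using N mset_set_atLeastAtMost_join[of "N - 2 * int t" "N - 1" N]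
      mset_set_atLeastAtMost_join[of 1 "N - 2 * int t - 2" "N - 2 * int t - 1"]
      mset_set_atLeastAtMost_join[of 1 "N - 2 * int t - 1" N] by simp
  finally show ?thesis using 1 by (simp add: graceful_path_def wrap_odd_def)
qed

text \<open>The reflection swaps the halves of the inner path, and \<open>N \<ge> 4 * t + 1\<close>
  puts the landing label \<open>N - 2 * t\<close> into the upper half.\<close>

lemma alternating_wrap_even:
  assumes "alternating ((N - 2 * int t - 1) div 2) p" "p \<noteq> []" "hd p = int t" "N \<ge> 4 * int t + 1"
  shows "alternating (N div 2) (wrap_even t N p)"
proof -
  have "(N - int t - x \<le> N div 2) = (\<not> x \<le> (N - 2 * int t - 1) div 2)" for x
    by presburger
  then have "alternating (N div 2) (map (\<lambda>x. (N - int t) - x) p)"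
    using assms(1) by (simp add: alternating_def successively_map)
  then show ?thesis
    unfolding wrap_even_def using assms
    by (intro alternating_append alternating_zigzag) (auto simp: hd_map)
qed

text \<open>The shift preserves the halves, and \<open>N \<ge> 4 * t + 2\<close> puts the landing
  label \<open>2 * t + 1\<close> into the lower one.\<close>

lemma alternating_wrap_odd:
  assumes "alternating ((N - 2 * int t - 2) div 2) p" "p \<noteq> []" "hd p = int t" "N \<ge> 4 * int t + 2"
  shows "alternating (N div 2) (wrap_odd t N p)"
proof -
  have "(x + (int t + 1) \<le> N div 2) = (x \<le> (N - 2 * int t - 2) div 2)" for x
    by presburger
  then have "alternating (N div 2) (map (\<lambda>x. x + (int t + 1)) p)"
    using assms(1) by (simp add: alternating_def successively_map)
  then have "alternating (N div 2) ([N] @ map (\<lambda>x. x + (int t + 1)) p)"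
    using assms by (intro alternating_append) (auto simp: hd_map alternating_def)
  from alternating_append[OF _ _ _ this, of "zigzag t (N - 2 * int t)"] show ?thesis
    using assms alternating_zigzag[of t "N div 2" "N - 2 * int t"] by (simp add: wrap_odd_def)
qed

section \<open>Symmetries of graceful paths\<close>

lemma graceful_path_reflect:
  assumes "graceful_path N p"
  shows "graceful_path N (map (\<lambda>x. N - x) p)"
  using assms
  by (simp add: graceful_path_def diffs_map_reflect mset_set_atLeastAtMost_image_reflect)

text \<open>On an alternating path, reversing both halves turns a difference \<open>d\<close> into \<open>N + 1 - d\<close>.\<close>

definition flip :: "int \<Rightarrow> int \<Rightarrow> int" where
  "flip N x = (if x \<le> N div 2 then N div 2 - x else N + N div 2 + 1 - x)"

lemma diffs_map_flip:
  assumes "alternating (N div 2) p" "set p \<subseteq> {0..N}"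
  shows "diffs (map (flip N) p) = map (\<lambda>d. N + 1 - d) (diffs p)"
  using assms
  by (induction p rule: diffs.induct) (auto simp: alternating_def flip_def)

lemma graceful_path_flip:
  assumes p: "graceful_path N p" and alt: "alternating (N div 2) p"
  shows "graceful_path N (map (flip N) p)" "alternating (N div 2) (map (flip N) p)"
proof -
  have N: "N \<ge> 0" using graceful_path_nonneg[OF p] .
  have inv: "flip N x \<in> {0..N} \<and> flip N (flip N x) = x \<and> (flip N x \<le> N div 2) = (x \<le> N div 2)"
    if "x \<in> {0..N}" for x
    using that by (auto simp: flip_def)
  have "bij_betw (flip N) {0..N} {0..N}"
    by (rule bij_betw_byWitness[where f' = "flip N"]) (use inv in auto)
  then have "image_mset (flip N) (mset_set {0..N}) = mset_set {0..N}"
    by (simp add: bij_betw_def image_mset_mset_set)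
  then show "graceful_path N (map (flip N) p)"
    using p alt by (simp add: graceful_path_def diffs_map_flip set_graceful_path[OF p]
        mset_set_atLeastAtMost_image_reflect)
  show "alternating (N div 2) (map (flip N) p)"
    using alt unfolding alternating_def successively_map
    by (rule successively_mono) (use inv set_graceful_path[OF p] in auto)
qed

section \<open>Graceful paths with a prescribed first label\<close>

text \<open>For \<open>N = 4 * t\<close> with \<open>t > 0\<close> the constructions fail:
  \<open>flip\<close> fixes \<open>t\<close>, and either jump out of the zigzag stays within one
  half.\<close>

lemma alternating_graceful_path_exists:
  assumes "2 * t \<le> N" "N \<noteq> 4 * t \<or> t = 0"
  shows "\<exists>p. graceful_path (int N) p \<and> alternating (int N div 2) p \<and> hd p = int t"
  using assms
proof (induction N arbitrary: t rule: less_induct)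
  case (less N)
  have main: "\<exists>p. graceful_path (int N) p \<and> alternating (int N div 2) p \<and> hd p = int s"
    if s: "N \<ge> 4 * s + 1" for s
    \<comment> \<open>If \<open>N = 6 s + 1\<close>, then \<open>wrap_even\<close> would need the excluded pair \<open>(4 s, s)\<close>.\<close>
  proof (cases "N = 6 * s + 1 \<and> s > 0")
    case True
    \<comment> \<open>\<open>wrap_odd\<close> leads to the pair \<open>(4 * s - 1, s)\<close>
      instead.\<close>
    define M where "M = N - 2 * s - 2"
    have M: "int M = int N - 2 * int s - 2" using True by (simp add: M_def)
    have "M < N" "2 * s \<le> M" "M \<noteq> 4 * s" using True by (auto simp: M_def)
    then obtain p where "graceful_path (int M) p" "alternating (int M div 2) p" "hd p = int s"
      using less.IH by blast
    then show ?thesis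
      using graceful_path_wrap_odd[of "int N" s p] alternating_wrap_odd[of "int N" s p]
        True
      by (intro exI[of _ "wrap_odd s (int N) p"]) (simp add: M graceful_path_def)
  next
    case False
    define M where "M = N - 2 * s - 1"
    have M: "int M = int N - 2 * int s - 1" using s by (simp add: M_def)
    have "M < N" "2 * s \<le> M" "M \<noteq> 4 * s \<or> s = 0" using False s by (auto simp: M_def)
    then obtain p where "graceful_path (int M) p" "alternating (int M div 2) p" "hd p = int s"
      using less.IH by blast
    then show ?thesis
      using graceful_path_wrap_even[of "int N" s p] alternating_wrap_even[of "int N" s p]
        s
      by (intro exI[of _ "wrap_even s (int N) p"]) (simp add: M graceful_path_def)
  qed
  consider "N \<ge> 4 * t + 1" | "N = 0" "t = 0" | "N < 4 * t"
    using less.prems by linarith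
  then show ?case
  proof cases
    case 1
    then show ?thesis by (rule main)
  next
    case 2
    then show ?thesis
      by (intro exI[of _ "[0]"]) (auto simp: graceful_path_def alternating_def)
  next
    case 3
    \<comment> \<open>\<open>flip\<close> sends the first label \<open>N div 2 - t\<close> to
      \<open>t\<close>.\<close>
    have "N \<ge> 4 * (N div 2 - t) + 1" using 3 less.prems by linarith
    from main[OF this] obtain p where p: "graceful_path (int N) p" "alternating (int N div 2) p"
      "hd p = int (N div 2 - t)" by blast
    have "flip (int N) (int (N div 2 - t)) = int t"
      using less.prems by (auto simp: flip_def zdiv_int of_nat_diff)
    then show ?thesis
      using graceful_path_flip[OF p(1,2)] p(1,3)
      by (intro exI[of _ "map (flip (int N)) p"]) (auto simp: graceful_path_def hd_map)
  qed
qed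

lemma graceful_path_exists:
  assumes "0 \<le> t" "t \<le> N"
  shows "\<exists>p. graceful_path N p \<and> hd p = t"
proof -
  have half: "\<exists>p. graceful_path (int N) p \<and> hd p = int t" if t: "2 * t \<le> N" for t N
  proof (cases "N = 4 * t \<and> t > 0")
    case True
    \<comment> \<open>\<open>wrap_even\<close> needs a path on \<open>0..2 * t - 1\<close> starting
      at \<open>t\<close>: reflect one starting at \<open>t - 1\<close>, which exists because
      \<open>2 * t - 1\<close> is odd.\<close>
    then have "2 * (t - 1) \<le> 2 * t - 1" "2 * t - 1 \<noteq> 4 * (t - 1)" by presburger+
    then obtain p where p: "graceful_path (int (2 * t - 1)) p" "hd p = int (t - 1)"
      using alternating_graceful_path_exists by blast
    have "graceful_path (int N - 2 * int t - 1) (map (\<lambda>x. int (2 * t - 1) - x) p)"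
      using graceful_path_reflect[OF p(1)] True by (simp add: of_nat_diff)
    then have "graceful_path (int N) (wrap_even t (int N) (map (\<lambda>x. int (2 * t - 1) - x) p))"
      using True p
      by (intro graceful_path_wrap_even) (auto simp: hd_map graceful_path_def of_nat_diff)
    then show ?thesis using hd_wrap(1) by blast
  next
    case False
    then show ?thesis using alternating_graceful_path_exists[of t N] t by blast
  qed
  show ?thesis
  proof (cases "2 * t \<le> N")
    case True
    then show ?thesis using half[of "nat t" "nat N"] assms by auto
  next
    case False
    then have "2 * nat (N - t) \<le> nat N" using assms by linarith
    from half[OF this] obtain p where p: "graceful_path N p" "hd p = N - t"
      using assms by auto
    then show ?thesis
      using graceful_path_reflect[OF p(1)]
      by (intro exI[of _ "map (\<lambda>x. N - x) p"]) (auto simp: graceful_path_def hd_map)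
  qed
qed

section \<open>Realizing the differences block by block\<close>

lemma append_block:
  assumes p: "mset p = mset_set {0..S}" "p \<noteq> []"
    and j: "S - last p < j" "last p \<le> S" "S \<ge> 0"
  shows "\<exists>q. q \<noteq> [] \<and> mset (p @ q) = mset_set {0..S + j} \<and>
    mset (diffs (p @ q)) = mset (diffs p) + mset_set {1..j} \<and> last q \<in> {S + 1..S + j}"
proof -
  \<comment> \<open>The jump of length \<open>j\<close> lands on \<open>last p + j\<close>;
    subtracting \<open>S + 1\<close> gives its position within the new block.\<close>
  obtain r where r: "graceful_path (j - 1) r" "hd r = last p + j - (S + 1)"
    using graceful_path_exists[of "last p + j - (S + 1)" "j - 1"] j by auto
  let ?q = "map (\<lambda>x. x + (S + 1)) r"
  have ne: "r \<noteq> []" using r by (simp add: graceful_path_def)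
  have "mset (p @ ?q) = mset_set {0..S} + mset_set {S + 1..S + j}"
    using p r by (simp add: graceful_path_def mset_set_atLeastAtMost_image_shift algebra_simps)
  moreover have "mset (diffs (p @ ?q)) = mset (diffs p) + (mset_set {1..j - 1} + mset_set {j..j})"
    using p r ne j by (simp add: diffs_append diffs_map_shift hd_map graceful_path_def)
  moreover have "last r \<in> {0..j - 1}" using set_graceful_path[OF r(1)] ne last_in_set by blast
  ultimately show ?thesis
    using j ne mset_set_atLeastAtMost_join[of 0 S "S + j"]
      mset_set_atLeastAtMost_join[of 1 "j - 1" j]
    by (intro exI[of _ ?q]) (auto simp: last_map)
qed

lemma positive_prefix:
  fixes a :: "nat \<Rightarrow> nat"
  assumes "\<forall>i \<in> {1..<m}. a i \<ge> a (Suc i)"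
  shows "\<exists>j\<le>m. \<forall>i\<in>{1..m}. a i > 0 \<longleftrightarrow> i \<le> j"
  using assms
proof (induction m)
  case (Suc m)
  then obtain j where j: "j \<le> m" "\<forall>i\<in>{1..m}. a i > 0 \<longleftrightarrow> i \<le> j" by auto
  show ?case
  proof (cases "a (Suc m) > 0")
    case True
    have "j = m"
    proof (rule ccontr)
      assume "j \<noteq> m"
      then have m: "m \<ge> 1" "\<not> m \<le> j" using j(1) by auto
      then have "a m = 0" using bspec[OF j(2), of m] by simp
      then show False using bspec[OF Suc.prems, of m] True m by simp
    qed
    then show ?thesis using j True by (intro exI[of _ "Suc m"]) (auto simp: le_Suc_eq)
  next
    case False
    then show ?thesis using j by (intro exI[of _ j]) (auto simp: le_Suc_eq)
  qed
qed auto

text \<open>Splits off the largest part \<open>j\<close> of the conjugate partition, so the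
  induction below appends the largest block last.\<close>

lemma exp_mset_decrement:
  assumes "j \<le> m" "\<forall>i\<in>{1..m}. a i > 0 \<longleftrightarrow> i \<le> j"
  shows "exp_mset m a = exp_mset m (\<lambda>i. a i - 1) + mset_set {1..j}"
proof -
  have "count (exp_mset m a) x = count (exp_mset m (\<lambda>i. a i - 1) + mset_set {1..j}) x" for x
    using assms by (auto simp: exp_mset_def count_sum count_mset_set' if_distrib
        sum.delta cong: if_cong)
  then show ?thesis by (rule multiset_eqI)
qed

text \<open>Induction on a bound \<open>k\<close> for the number of blocks. The last conjunct says
  that the path ends in its top block, as \<open>append_block\<close> requires for the next, no
  smaller one; \<open>n \<ge> 1\<close> covers the path \<open>[0]\<close> without blocks.\<close>

lemma linear_realization:
  fixes a :: "nat \<Rightarrow> nat"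
  assumes "\<forall>i \<in> {1..<m}. a i \<ge> a (Suc i)" "\<forall>i\<in>{1..m}. a i \<le> k"
  shows "\<exists>p. p \<noteq> [] \<and> mset p = mset_set {0..int (size (exp_mset m a))} \<and>
    mset (diffs p) = image_mset int (exp_mset m a) \<and>
    (\<forall>n\<ge>1. (\<forall>i\<in>{1..m}. a i > 0 \<longrightarrow> i \<le> n) \<longrightarrow> int (size (exp_mset m a)) - last p < int n)"
  using assms
proof (induction k arbitrary: a)
  case 0
  then have "exp_mset m a = {#}" by (simp add: exp_mset_def)
  then show ?case by (intro exI[of _ "[0]"]) auto
next
  case (Suc k)
  obtain j where j: "j \<le> m" "\<forall>i\<in>{1..m}. a i > 0 \<longleftrightarrow> i \<le> j"
    using positive_prefix[OF Suc.prems(1)] by blast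
  let ?b = "\<lambda>i. a i - 1" and ?S = "int (size (exp_mset m (\<lambda>i. a i - 1)))"
  have "\<forall>i \<in> {1..<m}. ?b i \<ge> ?b (Suc i)" "\<forall>i\<in>{1..m}. ?b i \<le> k"
    using Suc.prems by (auto simp: diff_le_mono le_diff_conv)
  from Suc.IH[OF this] obtain p where p: "p \<noteq> []" "mset p = mset_set {0..?S}"
    "mset (diffs p) = image_mset int (exp_mset m ?b)"
    "\<forall>n\<ge>1. (\<forall>i\<in>{1..m}. ?b i > 0 \<longrightarrow> i \<le> n) \<longrightarrow> ?S - last p < int n"
    by (elim exE conjE)
  have dec: "exp_mset m a = exp_mset m ?b + mset_set {1..j}"
    using exp_mset_decrement[OF j] .
  show ?case
  proof (cases "j = 0")
    case True
    then have "\<forall>i\<in>{1..m}. a i = 0" using j by auto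
    then have "\<forall>i\<in>{1..m}. ?b i = 0" by simp
    then have "?S - last p < int n" if "n \<ge> 1" for n using p(4) that by simp
    moreover have "exp_mset m a = exp_mset m ?b" using dec True by simp
    ultimately show ?thesis using p(1-3) by (intro exI[of _ p]) simp
  next
    case False
    have "\<forall>i\<in>{1..m}. ?b i > 0 \<longrightarrow> i \<le> j"
      using j(2) by (metis zero_less_diff zero_less_one less_trans)
    then have "?S - last p < int j" using p(4) False by simp
    moreover have "last p \<le> ?S"
      using last_in_set[OF p(1)] set_eq_interval[OF p(2)] by simp
    ultimately obtain q where q: "q \<noteq> []" "mset (p @ q) = mset_set {0..?S + int j}"
      "mset (diffs (p @ q)) = mset (diffs p) + mset_set {1..int j}"
      "last q \<in> {?S + 1..?S + int j}"
      using append_block[OF p(2,1), of "int j"] of_nat_0_le_iff by blast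
    have "image_mset int (mset_set {1..j}) = mset_set {1..int j}"
      by (subst image_mset_mset_set) (auto simp: image_int_atLeastAtMost)
    then have "mset (diffs (p @ q)) = image_mset int (exp_mset m a)"
      using q(3) p(3) dec by simp
    moreover have S: "int (size (exp_mset m a)) = ?S + int j" using dec by simp
    moreover have "int (size (exp_mset m a)) - last (p @ q) < int n"
      if "\<forall>i\<in>{1..m}. a i > 0 \<longrightarrow> i \<le> n" for n
    proof -
      have "j \<in> {1..m}" using j(1) False by simp
      then have "j \<le> n" using that j(2) by blast
      then show ?thesis using S q(1,4) by simp
    qed
    ultimately show ?thesis
      using q(1,2) by (intro exI[of _ "p @ q"]) simp
  qed
qed

section \<open>From lists of labels to edges of the complete graph\<close>

lemma path_edges_Cons: "path_edges (x # y # zs) = insert {x, y} (path_edges (y # zs))"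
proof -
  have "path_edges (x # y # zs) =
      (\<lambda>i. {(x # y # zs) ! i, (y # zs) ! i}) ` {..<Suc (length zs)}"
    unfolding path_edges_def by auto
  also have "\<dots> = insert {x, y} ((\<lambda>i. {(y # zs) ! i, zs ! i}) ` {..<length zs})"
    by (simp add: lessThan_Suc_eq_insert_0 image_image)
  also have "(\<lambda>i. {(y # zs) ! i, zs ! i}) ` {..<length zs} = path_edges (y # zs)"
    unfolding path_edges_def by auto
  finally show ?thesis .
qed

lemma path_edges_short [simp]: "path_edges [] = {}" "path_edges [x] = {}"
  by (auto simp: path_edges_def)

lemma edge_subset_of_path: "e \<in> path_edges p \<Longrightarrow> e \<subseteq> set p"
  by (auto simp: path_edges_def)

lemma finite_path_edges: "finite (path_edges p)"
  by (induction p rule: induct_list012) (auto simp: path_edges_Cons)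

lemma image_mset_path_edges:
  assumes "distinct p"
  shows "image_mset (\<lambda>e. int (Max e - Min e)) (mset_set (path_edges p)) = mset (diffs (map int p))"
  using assms
proof (induction p rule: induct_list012)
  case (3 x y zs)
  \<comment> \<open>\<open>x\<close> does not recur, so the set of edges loses no
    multiplicity.\<close>
  have "{x, y} \<notin> path_edges (y # zs)"
    using edge_subset_of_path[of "{x, y}" "y # zs"] 3 by auto
  then show ?case
    using 3 by (auto simp: path_edges_Cons finite_path_edges max_def min_def)
qed auto

theorem theorem1p9:
  fixes m v :: nat and a :: "nat \<Rightarrow> nat" and L :: "nat multiset"
  assumes "m \<ge> 1"
    and "L = exp_mset m a"
    and "v = size L + 1"
    and "admissible v L"
    and "\<forall>i \<in> {1..<m}. a i \<ge> a (Suc i)"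
    and "a m > 0"
  shows "\<exists>H. hamiltonian_path (complete_graph v) H \<and> length_list v H = L"
proof -
  have "\<forall>i\<in>{1..m}. a i \<le> (\<Sum>i=1..m. a i)" by (auto intro: member_le_sum)
  from linear_realization[OF assms(5) this] obtain q
    where q: "mset q = mset_set {0..int (size L)}" "mset (diffs q) = image_mset int L"
    using assms(2) by blast
  define p where "p = map nat q"
  have set_q: "set q = {0..int (size L)}" using set_eq_interval[OF q(1)] .
  then have pq: "map int p = q" by (auto simp: p_def intro: map_idI)
  have "distinct q"
    unfolding distinct_count_atmost_1 q(1) set_q[symmetric] by (simp add: count_mset_set')
  then have dp: "distinct p" using pq distinct_map by blast
  have "int ` set p = set q" using pq by (metis set_map)
  also have "\<dots> = int ` {0..<v}"
    unfolding set_q image_int_atLeastLessThan using assms(3) by force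
  finally have "int ` set p = int ` {0..<v}" .
  then have sp: "set p = {0..<v}" by (simp add: inj_image_eq_iff)
  have "image_mset int (image_mset (\<lambda>e. Max e - Min e) (mset_set (path_edges p))) =
      image_mset int L"
    using image_mset_path_edges[OF dp] q(2) pq by (simp add: multiset.map_comp comp_def)
  then have L: "image_mset (\<lambda>e. Max e - Min e) (mset_set (path_edges p)) = L"
    by (rule injD[OF multiset.inj_map[OF inj_of_nat]])
  \<comment> \<open>A difference of at most \<open>v div 2\<close> is its own cyclic length.\<close>
  have "edge_length v e = Max e - Min e" if "e \<in> path_edges p" for e
  proof -
    have "Max e - Min e \<in># L"
      unfolding L[symmetric] using that by (simp add: finite_path_edges)
    then have "Max e - Min e \<le> v div 2" using assms(4) unfolding admissible_def by blast
    then show ?thesis by (auto simp: edge_length_def)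
  qed
  then have "image_mset (edge_length v) (mset_set (path_edges p)) = L"
    unfolding L[symmetric] by (intro image_mset_cong) (simp add: finite_path_edges)
  moreover have "path_edges p \<subseteq> snd (complete_graph v)"
  proof
    fix e assume "e \<in> path_edges p"
    then obtain i where i: "e = {p ! i, p ! Suc i}" "Suc i < length p"
      by (auto simp: path_edges_def)
    then have "p ! i \<noteq> p ! Suc i" using dp by (simp add: nth_eq_iff_index_eq)
    moreover have "p ! i < v" "p ! Suc i < v" 
      using i(2) sp nth_mem[of i p] nth_mem[of "Suc i" p] by auto
    ultimately show "e \<in> snd (complete_graph v)" using i by (auto simp: complete_graph_def)
  qed
  ultimately show ?thesis
  proof (intro exI conjI)
    show "hamiltonian_path (complete_graph v) (set p, path_edges p)"
      unfolding hamiltonian_path_def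
      using dp sp \<open>path_edges p \<subseteq> snd (complete_graph v)\<close>
      by (intro exI[of _ p]) (simp add: complete_graph_def)
  qed (simp add: length_list_def)
qed

end
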